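(* Let $x\in\mathcal{M}$ and suppose $\beta\ge\beta_x$. Then for every $y\in\Omega_x$, $$\|\nabla h(y)\|\ \ge\ \frac{\beta\,\sigma_{x,c}}{8(M_{x,A}+1)}\,\|c(y)\|.$$ Moreover, every first-order stationary point of (CDF) in $\Omega_x$ is a first-order stationary point of (OCP).
   Context: Setting. $\|\cdot\|$ is the $\ell_2$-norm of vectors or the induced operator norm. Let $f:\mathbb{R}^n\to\mathbb{R}$, $c:\mathbb{R}^n\to\mathbb{R}^p$ be differentiable, $\mathcal{M}=\{x\in\mathbb{R}^n: c(x)=0\}$, and consider the problem (OCP): minimize $f(x)$ subject to $c(x)=0$. $J_c(x)\in\mathbb{R}^{n\times p}$ is the transposed Jacobian of $c$ (entry $(i,j)$ is $\partial c_j/\partial x_i$). Assumed: $\nabla f$ and $J_c$ are locally Lipschitz continuous on $\mathbb{R}^n$, and $J_c(x)$ has full column rank for every $x\in\mathcal{M}$. Let $\mathcal{A}:\mathbb{R}^n\to\mathbb{R}^n$ be differentiable with transposed Jacobian $J_{\mathcal{A}}(x)\in\mathbb{R}^{n\times n}$ (entry $(i,j)$ is $\partial\mathcal{A}_j/\partial x_i$), such that $J_{\mathcal{A}}$ is locally Lipschitz continuous on $\mathbb{R}^n$, $\mathcal{A}(x)=x$ for $x\in\mathcal{M}$, and $J_{\mathcal{A}}(x)J_c(x)=0$ for $x\in\mathcal{M}$. Put $g(x)=f(\mathcal{A}(x))$ and, for a penalty parameter $\beta>0$, $h(x)=f(\mathcal{A}(x))+\frac{\beta}{2}\|c(x)\|^2$;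 (CDF) is the problem of minimizing $h$ over $\mathbb{R}^n$. $\nabla f(\mathcal{A}(y))$ denotes $\nabla f$ evaluated at $\mathcal{A}(y)$. Constants. For $x\in\mathcal{M}$, $\rho_x$ is the largest $\rho\in(0,1]$ with $\inf\{\sigma_{\min}(J_c(y)):\|y-x\|\le\rho\}\ge\frac12\sigma_{\min}(J_c(x))$ ($\sigma_{\min}$ = smallest singular value); $\Theta_x=\{y:\|y-x\|\le\rho_x\}$; $\sigma_{x,c}=\sigma_{\min}(J_c(x))$; $M_{x,f}=\sup_{y\in\Theta_x}\|\nabla f(\mathcal{A}(y))\|$; $M_{x,c}=\sup_{y\in\Theta_x}\|J_c(y)\|$; $M_{x,A}=\sup_{y\in\Theta_x}\|J_{\mathcal{A}}(y)\|$; $L_{x,g},L_{x,c},L_{x,A},L_{x,b}$ are the least Lipschitz constants on $\Theta_x$ (suprema of difference quotients over $y\ne z$ in $\Theta_x$) of $\nabla g$, $J_c$, $J_{\mathcal{A}}$, and $y\mapsto J_{\mathcal{A}}(y)J_c(\mathcal{A}(y))$ respectively. Put $$\varepsilon_x=\min\Big\{\frac{\rho_x}{2},\ \frac{\sigma_{x,c}}{32L_{x,c}(M_{x,A}+1)},\ \frac{\sigma_{x,c}^2}{8L_{x,b}M_{x,c}}\Big\}$$ (a fraction with zero denominator is read as $+\infty$), $\Omega_x=\{y\in\mathbb{R}^n:\|y-x\|\le\varepsilon_x\}$, and $$\beta_x=\max\Big\{\frac{128L_{x,g}(M_{x,A}+1)^2}{\sigma_{x,c}^2},\ \frac{64M_{x,f}(M_{x,A}+1)L_{x,b}}{\sigma_{x,c}^3},\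 \frac{16M_{x,f}L_{x,A}(2M_{x,A}+1)}{\sigma_{x,c}^2}\Big\}.$$ Stationarity. $x$ is a first-order stationary point of (OCP) if $c(x)=0$ and $\nabla f(x)=\sum_{i=1}^p\tilde\lambda_i\nabla c_i(x)$ for some $\tilde\lambda\in\mathbb{R}^p$. $x$ is a first-order stationary point of (CDF) if $\nabla h(x)=0$. *)

theory Defs
  imports "HOL-Analysis.Analysis"
begin

definition grad :: "('a::real_inner \<Rightarrow> real) \<Rightarrow> 'a \<Rightarrow> 'a" where
  "grad f x = (THE D. GDERIV f x :> D)"

(* Entry (i, j) is the partial derivative of the j-th component of F in the i-th coordinate. *)
definition tjac :: "(real^'n \<Rightarrow> real^'m) \<Rightarrow> real^'n \<Rightarrow> real^'m^'n" where
  "tjac F x = transpose (jacobian F (at x))"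

(* The library norm and distance on real^'m^'n are the Frobenius ones. Passing to bounded
   linear functions makes norm and dist refer to the induced (spectral) operator norm. *)
definition mat_op :: "real^'m^'n \<Rightarrow> ((real^'m) \<Rightarrow>\<^sub>L (real^'n))" where
  "mat_op M = Blinfun (\<lambda>v. M *v v)"

definition locally_lipschitz :: "('a::metric_space \<Rightarrow> 'b::metric_space) \<Rightarrow> bool" where
  "locally_lipschitz F \<longleftrightarrow> (\<forall>x. \<exists>u>0. \<exists>L. L-lipschitz_on (cball x u) F)"

definition least_lipschitz :: "('a::metric_space \<Rightarrow> 'b::metric_space) \<Rightarrow> 'a set \<Rightarrow> real" where
  "least_lipschitz F S =
     (SUP (y, z) \<in> {(y, z). y \<in> S \<and> z \<in> S \<and> y \<noteq> z}. dist (F y) (F z) / dist y z)"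

(* Singular values as square roots of the eigenvalues of the Gram matrix M^T M. This is used
   for matrices with at least as many rows as columns. For a wide matrix it would also count
   the zero eigenvalues of M^T M, which other conventions omit. *)
definition singular_value :: "real^'m^'n \<Rightarrow> real \<Rightarrow> bool" where
  "singular_value M s \<longleftrightarrow>
     0 \<le> s \<and> (\<exists>v. v \<noteq> 0 \<and> (transpose M ** M) *v v = s\<^sup>2 *\<^sub>R v)"

definition sigma_min :: "real^'m^'n \<Rightarrow> real" where
  "sigma_min M = (LEAST s. singular_value M s)"

definition feasible :: "(real^'n \<Rightarrow> real^'p) \<Rightarrow> (real^'n) set" where
  "feasible c = {x. c x = 0}"

definition cdf_fun ::
  "(real^'n \<Rightarrow> real) \<Rightarrow> (real^'n \<Rightarrow> real^'p) \<Rightarrow> (real^'n \<Rightarrow> real^'n) \<Rightarrow> real \<Rightarrow> real^'n \<Rightarrow> real" where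
  "cdf_fun f c A \<beta> x = f (A x) + \<beta> / 2 * (norm (c x))\<^sup>2"

definition ocp_stationary :: "(real^'n \<Rightarrow> real) \<Rightarrow> (real^'n \<Rightarrow> real^'p) \<Rightarrow> real^'n \<Rightarrow> bool" where
  "ocp_stationary f c x \<longleftrightarrow>
     c x = 0 \<and> (\<exists>\<mu>::real^'p. grad f x = (\<Sum>i\<in>UNIV. (\<mu> $ i) *\<^sub>R grad (\<lambda>z. c z $ i) x))"

definition cdf_stationary ::
  "(real^'n \<Rightarrow> real) \<Rightarrow> (real^'n \<Rightarrow> real^'p) \<Rightarrow> (real^'n \<Rightarrow> real^'n) \<Rightarrow> real \<Rightarrow> real^'n \<Rightarrow> bool" where
  "cdf_stationary f c A \<beta> x \<longleftrightarrow> grad (cdf_fun f c A \<beta>) x = 0"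

definition rho :: "(real^'n \<Rightarrow> real^'p) \<Rightarrow> real^'n \<Rightarrow> real" where
  "rho c x = (GREATEST r. 0 < r \<and> r \<le> 1 \<and>
     (INF y\<in>cball x r. sigma_min (tjac c y)) \<ge> 1 / 2 * sigma_min (tjac c x))"

definition Theta :: "(real^'n \<Rightarrow> real^'p) \<Rightarrow> real^'n \<Rightarrow> (real^'n) set" where
  "Theta c x = {y. norm (y - x) \<le> rho c x}"

definition sigma_c :: "(real^'n \<Rightarrow> real^'p) \<Rightarrow> real^'n \<Rightarrow> real" where
  "sigma_c c x = sigma_min (tjac c x)"

definition M_f ::
  "(real^'n \<Rightarrow> real) \<Rightarrow> (real^'n \<Rightarrow> real^'p) \<Rightarrow> (real^'n \<Rightarrow> real^'n) \<Rightarrow> real^'n \<Rightarrow> real" where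
  "M_f f c A x = (SUP y\<in>Theta c x. norm (grad f (A y)))"

definition M_c :: "(real^'n \<Rightarrow> real^'p) \<Rightarrow> real^'n \<Rightarrow> real" where
  "M_c c x = (SUP y\<in>Theta c x. norm (mat_op (tjac c y)))"

definition M_A :: "(real^'n \<Rightarrow> real^'p) \<Rightarrow> (real^'n \<Rightarrow> real^'n) \<Rightarrow> real^'n \<Rightarrow> real" where
  "M_A c A x = (SUP y\<in>Theta c x. norm (mat_op (tjac A y)))"

definition L_g ::
  "(real^'n \<Rightarrow> real) \<Rightarrow> (real^'n \<Rightarrow> real^'p) \<Rightarrow> (real^'n \<Rightarrow> real^'n) \<Rightarrow> real^'n \<Rightarrow> real" where
  "L_g f c A x = least_lipschitz (grad (\<lambda>y. f (A y))) (Theta c x)"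

definition L_c :: "(real^'n \<Rightarrow> real^'p) \<Rightarrow> real^'n \<Rightarrow> real" where
  "L_c c x = least_lipschitz (\<lambda>y. mat_op (tjac c y)) (Theta c x)"

definition L_A :: "(real^'n \<Rightarrow> real^'p) \<Rightarrow> (real^'n \<Rightarrow> real^'n) \<Rightarrow> real^'n \<Rightarrow> real" where
  "L_A c A x = least_lipschitz (\<lambda>y. mat_op (tjac A y)) (Theta c x)"

definition L_b :: "(real^'n \<Rightarrow> real^'p) \<Rightarrow> (real^'n \<Rightarrow> real^'n) \<Rightarrow> real^'n \<Rightarrow> real" where
  "L_b c A x = least_lipschitz (\<lambda>y. mat_op (tjac A y ** tjac c (A y))) (Theta c x)"

definition div_or_top :: "real \<Rightarrow> real \<Rightarrow> ereal" where
  "div_or_top a b = (if b = 0 then \<infinity> else ereal (a / b))"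

definition eps :: "(real^'n \<Rightarrow> real^'p) \<Rightarrow> (real^'n \<Rightarrow> real^'n) \<Rightarrow> real^'n \<Rightarrow> ereal" where
  "eps c A x = Min {ereal (rho c x / 2),
     div_or_top (sigma_c c x) (32 * L_c c x * (M_A c A x + 1)),
     div_or_top ((sigma_c c x)\<^sup>2) (8 * L_b c A x * M_c c x)}"

definition Omega :: "(real^'n \<Rightarrow> real^'p) \<Rightarrow> (real^'n \<Rightarrow> real^'n) \<Rightarrow> real^'n \<Rightarrow> (real^'n) set" where
  "Omega c A x = {y. ereal (norm (y - x)) \<le> eps c A x}"

definition beta_thr ::
  "(real^'n \<Rightarrow> real) \<Rightarrow> (real^'n \<Rightarrow> real^'p) \<Rightarrow> (real^'n \<Rightarrow> real^'n) \<Rightarrow> real^'n \<Rightarrow> real" where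
  "beta_thr f c A x = Max {
     128 * L_g f c A x * (M_A c A x + 1)\<^sup>2 / (sigma_c c x)\<^sup>2,
     64 * M_f f c A x * (M_A c A x + 1) * L_b c A x / (sigma_c c x) ^ 3,
     16 * M_f f c A x * L_A c A x * (2 * M_A c A x + 1) / (sigma_c c x)\<^sup>2}"

end

theory Submission
  imports Defs
begin

text \<open>The gradient of the penalty function \<open>h\<close> at \<open>y\<close> is \<open>J\<^sub>A(y) \<nabla>f(A y) + \<beta> J\<^sub>c(y) c(y)\<close>, and the danger is that
the two terms cancel. On the feasible set they cannot. Let \<open>z\<close> be feasible, and put \<open>P = J\<^sub>A(z)\<close> and
\<open>J = J\<^sub>c(z)\<close>. Since \<open>A\<close> is the identity on the feasible set, \<open>P^T\<close> fixes every tangent vector, and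
by full rank the tangent space is the whole kernel of \<open>J^T\<close>. Together with \<open>P J = 0\<close> this shows
that \<open>P\<close> is a projection (\<open>idempotent_if_transpose_fixes_kernel\<close>). The complementary projection
\<open>I - P\<close>, of norm at most \<open>M_A + 1\<close>, therefore kills \<open>P \<nabla>f\<close> and leaves \<open>J c(y)\<close> unchanged.

For infeasible \<open>y\<close>, take \<open>z\<close> to be the feasible point closest to \<open>y\<close> and apply \<open>I - P\<close> to the gradient
at \<open>y\<close> (\<open>norm_projected_sum_lower_bound\<close>). Replacing the matrices at \<open>y\<close> by those at \<open>z\<close> costs Lipschitz
terms. The one from \<open>J\<^sub>c\<close> is small compared with \<open>\<sigma>\<close> by the choice of the radius. The one from \<open>J\<^sub>A\<close>
is proportional to \<open>|y - z|\<close>. As \<open>y - z\<close> is normal to the feasible set, it lies in the range of \<open>J\<close>,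
on which \<open>J^T\<close> is bounded below, and so \<open>|y - z| \<le> 2 |c(y)| / \<sigma>\<close>. This term is then dominated by the
penalty because of the threshold on \<open>\<beta>\<close>.

A stationary point of \<open>h\<close> near \<open>x\<close> is thus feasible, and there \<open>J\<^sub>A \<nabla>f = 0\<close>. Pairing this with tangent vectors
shows that \<open>\<nabla>f\<close> is normal to the feasible set, hence a combination of the constraint gradients.

The geometric input, namely that \<open>P^T\<close> fixes the kernel of \<open>J^T\<close> and that \<open>y - z\<close> is normal, comes from
the Lagrange rule \<open>derivative_zero_on_kernel\<close>. That rule rests on an exact-penalty argument for
finding feasible points (\<open>exact_root_near\<close>), which shows that kernel vectors are tangent.\<close>

section \<open>Matrices, the operator norm and the smallest singular value\<close>

lemma inner_transpose_matrix_vector: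
  fixes M :: "real^'m^'n"
  shows "(transpose M *v u) \<bullet> v = u \<bullet> (M *v v)"
  by (metis dot_lmul_matrix transpose_matrix_vector)

lemma mat_op_apply: "blinfun_apply (mat_op M) v = M *v v"
  unfolding mat_op_def by (simp add: bounded_linear_Blinfun_apply)

lemma mat_op_diff: "mat_op (M - N) = mat_op M - mat_op N"
  by (rule blinfun_eqI)
     (simp add: mat_op_apply blinfun.diff_left matrix_vector_mult_diff_rdistrib)

lemma norm_matrix_vector_mult_le: "norm (M *v v) \<le> norm (mat_op M) * norm v"
  using norm_blinfun[of "mat_op M" v] by (simp add: mat_op_apply)

text \<open>The spectral norm is invariant under transposition. This inequality follows by
Cauchy--Schwarz from \<open>|M^T u|^2 = u \<bullet> M M^T u\<close>.\<close>
lemma norm_transpose_matrix_vector_mult_le: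
  fixes M :: "real^'m^'n"
  shows "norm (transpose M *v u) \<le> norm (mat_op M) * norm u"
proof (cases "transpose M *v u = 0")
  case False
  have "norm (transpose M *v u) * norm (transpose M *v u) = u \<bullet> (M *v (transpose M *v u))"
    by (metis inner_transpose_matrix_vector power2_eq_square power2_norm_eq_inner)
  also have "\<dots> \<le> norm u * norm (M *v (transpose M *v u))"
    by (rule norm_cauchy_schwarz)
  also have "\<dots> \<le> norm u * (norm (mat_op M) * norm (transpose M *v u))"
    by (intro mult_left_mono norm_matrix_vector_mult_le norm_ge_zero)
  finally have "norm (transpose M *v u) * norm (transpose M *v u)
      \<le> (norm (mat_op M) * norm u) * norm (transpose M *v u)"
    by (simp add: mult_ac)
  then show ?thesis using False by simp
qed simp

lemma norm_matrix_diff_vector_mult_le: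
  "norm (M *v v - N *v v) \<le> dist (mat_op M) (mat_op N) * norm v"
  using norm_matrix_vector_mult_le[of "M - N" v]
  by (simp add: mat_op_diff dist_norm matrix_vector_mult_diff_rdistrib)

lemma bounded_below_perturb:
  fixes M N :: "real^'m^'n"
  assumes "\<And>v. s * norm v \<le> norm (M *v v)"
  shows "(s - dist (mat_op N) (mat_op M)) * norm v \<le> norm (N *v v)"
proof -
  have "norm (M *v v) \<le> norm (N *v v) + norm (N *v v - M *v v)"
    using norm_triangle_sub[of "M *v v" "N *v v"] by (simp add: norm_minus_commute)
  then show ?thesis
    using assms[of v] norm_matrix_diff_vector_mult_le[of N v M] by (simp add: algebra_simps)
qed

text \<open>This is the variational description of the smallest singular value. A minimizer \<open>v\<close> of \<open>|M w|\<close>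
on the unit sphere, with minimum \<open>m\<close>, minimizes the nonnegative quadratic form
\<open>|M w|^2 - m^2 |w|^2\<close>, so its gradient there, twice
\<open>q = M^T M v - m^2 v\<close>, vanishes and \<open>m\<close> is a singular value. No singular value is smaller, since \<open>M^T M w = s^2 w\<close> gives \<open>|M w| = s |w|\<close>.\<close>
lemma sigma_min_attained:
  fixes M :: "real^'m^'n"
  obtains v where "norm v = 1" "norm (M *v v) = sigma_min M"
    and "\<And>w. sigma_min M * norm w \<le> norm (M *v w)"
proof -
  have "\<exists>v\<in>sphere (0::real^'m) 1. \<forall>w\<in>sphere 0 1. norm (M *v v) \<le> norm (M *v w)"
  proof (rule continuous_attains_inf)
    show "sphere (0::real^'m) 1 \<noteq> {}" by simp
    show "continuous_on (sphere 0 1) (\<lambda>v. norm (M *v v))"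
      by (intro continuous_intros)
  qed simp
  then obtain v where v: "norm v = 1"
    and min: "\<And>w. norm w = 1 \<Longrightarrow> norm (M *v v) \<le> norm (M *v w)"
    by (auto simp: sphere_def dist_norm)
  define m where "m = norm (M *v v)"
  have below: "m * norm w \<le> norm (M *v w)" for w
  proof (cases "w = 0")
    case False
    have "m \<le> norm (M *v ((1 / norm w) *\<^sub>R w))"
      unfolding m_def using False by (intro min) simp
    then show ?thesis
      using False by (simp add: matrix_vector_mult_scaleR field_simps)
  qed simp
  define q where "q = (transpose M ** M) *v v - m\<^sup>2 *\<^sub>R v"
  have gram: "((transpose M ** M) *v u) \<bullet> w = (M *v u) \<bullet> (M *v w)" for u w
    by (simp only: matrix_vector_mul_assoc[symmetric] inner_transpose_matrix_vector)
  have "singular_value M m"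
  proof -
    have pos: "0 \<le> 2 * t * (q \<bullet> q) + t\<^sup>2 * (norm (M *v q))\<^sup>2" for t
    proof -
      have "(m * norm (v + t *\<^sub>R q))\<^sup>2 \<le> (norm (M *v (v + t *\<^sub>R q)))\<^sup>2"
        by (intro power_mono below) (simp add: m_def)
      moreover have "(norm (M *v (v + t *\<^sub>R q)))\<^sup>2
          = m\<^sup>2 + 2 * t * ((M *v v) \<bullet> (M *v q)) + t\<^sup>2 * (norm (M *v q))\<^sup>2"
        unfolding m_def power2_norm_eq_inner
        by (simp add: matrix_vector_right_distrib matrix_vector_mult_scaleR inner_add_left
            inner_add_right inner_commute power2_eq_square algebra_simps)
      moreover have "(norm (v + t *\<^sub>R q))\<^sup>2 = 1 + 2 * t * (v \<bullet> q) + t\<^sup>2 * (norm q)\<^sup>2"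
        using v unfolding power2_norm_eq_inner norm_eq_1
        by (simp add: inner_add_left inner_add_right inner_commute power2_eq_square algebra_simps)
      moreover have "q \<bullet> q = (M *v v) \<bullet> (M *v q) - m\<^sup>2 * (v \<bullet> q)"
        using gram[of v q] by (simp add: q_def inner_diff_left)
      moreover define P where "P = m\<^sup>2 * (t\<^sup>2 * (norm q)\<^sup>2)"
      moreover have "P \<ge> 0" by (simp add: P_def)
      moreover have "m\<^sup>2 * (1 + 2 * t * (v \<bullet> q) + t\<^sup>2 * (norm q)\<^sup>2)
          = m\<^sup>2 + 2 * t * (m\<^sup>2 * (v \<bullet> q)) + P"
        by (simp add: P_def distrib_left)
      ultimately show ?thesis
        by (simp only: power_mult_distrib right_diff_distrib)
    qed
    have "q \<bullet> q = 0"
    proof (rule ccontr)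
      assume "q \<bullet> q \<noteq> 0"
      then have q: "q \<bullet> q > 0" by (simp add: inner_gt_zero_iff)
      define a where "a = q \<bullet> q"
      define b where "b = (norm (M *v q))\<^sup>2"
      have ab: "a > 0" "b \<ge> 0" using q by (auto simp: a_def b_def)
      \<comment> \<open>A step \<open>-r q\<close> this short makes the linear term dominate the quadratic one.\<close>
      define r where "r = a / (b + 1)"
      have r: "r > 0" "a = r * (b + 1)" using ab by (simp_all add: r_def)
      have "0 \<le> 2 * (- r) * a + (- r)\<^sup>2 * b"
        using pos[of "- r"] by (simp only: a_def b_def)
      also have "\<dots> = - (r\<^sup>2 * (b + 2))"
        unfolding r(2) by (simp add: algebra_simps power2_eq_square)
      also have "\<dots> < 0" using ab r(1) by simp
      finally show False by simp
    qed
    then have "(transpose M ** M) *v v = m\<^sup>2 *\<^sub>R v" by (simp add: q_def)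
    then show ?thesis
      unfolding singular_value_def using v by (auto simp: m_def intro!: exI[of _ v])
  qed
  moreover have "m \<le> s" if "singular_value M s" for s
  proof -
    from that obtain w where s: "0 \<le> s" "w \<noteq> 0" "(transpose M ** M) *v w = s\<^sup>2 *\<^sub>R w"
      unfolding singular_value_def by blast
    have "(m * norm w)\<^sup>2 \<le> (norm (M *v w))\<^sup>2"
      by (intro power_mono below) (simp add: m_def)
    also have "\<dots> = (s * norm w)\<^sup>2"
      using gram[of w w] s(3) by (simp add: power2_norm_eq_inner power_mult_distrib)
    finally have "m * norm w \<le> s * norm w"
      by (rule power2_le_imp_le) (simp add: s)
    then show ?thesis using s(2) by simp
  qed
  ultimately have "sigma_min M = m"
    unfolding sigma_min_def by (intro Least_equality)
  then show ?thesis using that v below m_def by metis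
qed

lemma sigma_min_le: "sigma_min M * norm w \<le> norm (M *v w)"
  by (metis sigma_min_attained)

lemma sigma_min_pos:
  fixes M :: "real^'m^'n"
  assumes "rank M = CARD('m)"
  shows "0 < sigma_min M"
proof -
  obtain v where v: "norm v = 1" "norm (M *v v) = sigma_min M"
    using sigma_min_attained[of M] by metis
  have "M *v v \<noteq> 0"
    using assms v(1) unfolding full_rank_injective matrix_left_invertible_injective[symmetric]
      matrix_left_invertible_ker by force
  then show ?thesis using v(2) by (metis norm_ge_zero norm_eq_zero order_le_less)
qed

text \<open>Subtract from \<open>v\<close> its least-squares approximation \<open>M l\<close>, where \<open>l\<close> solves the normal equations
\<open>M^T M l = M^T v\<close>. The residual lies in the kernel of \<open>M^T\<close> and is orthogonal both to \<open>v\<close> and to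
\<open>M l\<close>, hence to itself.\<close>
lemma in_range_if_orthogonal_to_transpose_kernel:
  fixes M :: "real^'m^'n"
  assumes inj: "rank M = CARD('m)"
    and orth: "\<And>d. transpose M *v d = 0 \<Longrightarrow> v \<bullet> d = 0"
  obtains l where "v = M *v l"
proof -
  let ?G = "transpose M ** M"
  have "inj ((*v) ?G)"
  proof (subst matrix_left_invertible_injective[symmetric], subst matrix_left_invertible_ker,
      intro allI impI)
    fix l assume "?G *v l = 0"
    then have "(M *v l) \<bullet> (M *v l) = 0"
      by (metis inner_transpose_matrix_vector inner_zero_left matrix_vector_mul_assoc)
    then have "norm (M *v l) = 0" by simp
    then have "sigma_min M * norm l \<le> 0" using sigma_min_le[of M l] by simp
    then show "l = 0" using sigma_min_pos[OF inj] by (simp add: mult_le_0_iff)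
  qed
  then have "surj ((*v) ?G)"
    by (simp add: linear_injective_imp_surjective)
  then obtain l where l: "transpose M *v v = ?G *v l" by (metis surjD)
  let ?d = "v - M *v l"
  have ker: "transpose M *v ?d = 0"
    by (simp add: l matrix_vector_mult_diff_distrib matrix_vector_mul_assoc
        del: transpose_matrix_vector)
  then have "(M *v l) \<bullet> ?d = 0"
    by (metis inner_commute inner_transpose_matrix_vector inner_zero_left)
  then have "?d \<bullet> ?d = 0" using orth[OF ker] by (simp add: inner_diff_left)
  then have "v = M *v l" by simp
  then show ?thesis by (rule that)
qed

text \<open>Cauchy--Schwarz for \<open>|M l|^2 = M^T (M l) \<bullet> l\<close>. The argument must lie in the range of \<open>M\<close>, since
\<open>M^T\<close> vanishes on vectors orthogonal to it.\<close>
lemma transpose_bounded_below_on_range: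
  fixes M :: "real^'m^'n"
  assumes s: "0 \<le> s" "\<And>v. s * norm v \<le> norm (M *v v)"
  shows "s * norm (M *v l) \<le> norm (transpose M *v (M *v l))"
proof (cases "M *v l = 0")
  case False
  then have l: "norm l > 0" by auto
  have "(s * norm l) * norm (M *v l) \<le> norm (M *v l) * norm (M *v l)"
    by (intro mult_right_mono s norm_ge_zero)
  also have "\<dots> = (transpose M *v (M *v l)) \<bullet> l"
    by (metis inner_transpose_matrix_vector power2_eq_square power2_norm_eq_inner)
  also have "\<dots> \<le> norm (transpose M *v (M *v l)) * norm l"
    by (rule norm_cauchy_schwarz)
  finally have "(s * norm (M *v l)) * norm l \<le> norm (transpose M *v (M *v l)) * norm l"
    by (simp add: mult_ac)
  then show ?thesis using l by simp
qed simp

section \<open>Derivatives, gradients and Lipschitz moduli\<close>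

lemma has_derivative_tjac:
  assumes "F differentiable (at z)"
  shows "(F has_derivative (\<lambda>k. transpose (tjac F z) *v k)) (at z)"
  using assms unfolding jacobian_works tjac_def by (simp del: transpose_matrix_vector)

lemma grad_eqI:
  assumes "GDERIV f x :> D"
  shows "grad f x = D"
  unfolding grad_def
proof (rule the_equality)
  fix E assume "GDERIV f x :> E"
  then have "(\<lambda>h. h \<bullet> E) = (\<lambda>h. h \<bullet> D)"
    using assms has_derivative_unique unfolding gderiv_def by blast
  then have "(E - D) \<bullet> E = (E - D) \<bullet> D" by (rule fun_cong)
  then have "(E - D) \<bullet> (E - D) = 0" by (simp add: inner_diff_right)
  then show "E = D" by simp
qed (rule assms)

lemma GDERIV_grad:
  fixes f :: "'a::euclidean_space \<Rightarrow> real"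
  assumes "f differentiable (at x)"
  shows "GDERIV f x :> grad f x"
proof -
  obtain f' where f': "(f has_derivative f') (at x)"
    using assms unfolding differentiable_def by blast
  then have "f' h = h \<bullet> adjoint f' 1" for h
    using adjoint_works[of f' h 1] has_derivative_linear[OF f'] by simp
  then have "f' = (\<lambda>h. h \<bullet> adjoint f' 1)" by blast
  then have "GDERIV f x :> adjoint f' 1"
    unfolding gderiv_def using f' by metis
  then show ?thesis using grad_eqI by metis
qed

lemma locally_lipschitz_imp_continuous_on:
  assumes "locally_lipschitz F"
  shows "continuous_on S F"
proof (intro continuous_at_imp_continuous_on ballI)
  fix x
  obtain u L where "u > 0" "L-lipschitz_on (cball x u) F"
    using assms unfolding locally_lipschitz_def by blast
  then have "continuous_on (ball x u) F"
    by (meson ball_subset_cball continuous_on_subset lipschitz_on_continuous_on)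
  then show "isCont F x"
    using \<open>u > 0\<close> by (simp add: continuous_on_eq_continuous_at)
qed

text \<open>The supremum of difference quotients is a Lipschitz constant only if it is finite. On a compact
set local Lipschitz continuity guarantees this.\<close>
lemma dist_le_least_lipschitz:
  assumes F: "locally_lipschitz F" and S: "compact S" and yz: "y \<in> S" "z \<in> S"
  shows "dist (F y) (F z) \<le> least_lipschitz F S * dist y z"
proof (cases "y = z")
  case False
  have "local_lipschitz {0::real} S (\<lambda>_. F)"
  proof (rule local_lipschitzI)
    fix t x
    obtain u L where "u > 0" "L-lipschitz_on (cball x u) F"
      using F unfolding locally_lipschitz_def by blast
    then show "\<exists>u>0. \<exists>L. \<forall>t\<in>cball t u \<inter> {0}. L-lipschitz_on (cball x u \<inter> S) F"
      by (meson inf_le1 lipschitz_on_subset)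
  qed
  then obtain L where L: "L-lipschitz_on S F"
    using local_lipschitz_compact_implies_lipschitz[where X = S and T = "{0::real}" and f = "\<lambda>_. F"] S
    by auto
  let ?P = "{(y, z). y \<in> S \<and> z \<in> S \<and> y \<noteq> z}"
  have "bdd_above ((\<lambda>(y, z). dist (F y) (F z) / dist y z) ` ?P)"
    using lipschitz_onD[OF L] by (intro bdd_aboveI2[of _ _ L]) (auto simp: field_simps)
  then have "dist (F y) (F z) / dist y z \<le> least_lipschitz F S"
    unfolding least_lipschitz_def using yz False
    by (intro cSUP_upper2[where x = "(y, z)"]) auto
  then show ?thesis using False by (simp add: field_simps)
qed simp

lemma norm_diff_linearization_le:
  fixes F :: "real^'n \<Rightarrow> real^'m"
  assumes diff: "\<And>u. F differentiable (at u)"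
    and B: "\<And>u. u \<in> closed_segment z y \<Longrightarrow> dist (mat_op (tjac F u)) (mat_op (tjac F z)) \<le> B"
  shows "norm (F y - F z - transpose (tjac F z) *v (y - z)) \<le> B * norm (y - z)"
proof -
  let ?R = "\<lambda>u. F u - transpose (tjac F z) *v u"
  let ?R' = "\<lambda>u k. transpose (tjac F u) *v k - transpose (tjac F z) *v k"
  have "norm (?R y - ?R z) \<le> B * norm (y - z)"
  proof (rule differentiable_bound[of "closed_segment z y" _ ?R'])
    fix u assume u: "u \<in> closed_segment z y"
    have "(?R has_derivative ?R' u) (at u)"
      by (intro has_derivative_diff has_derivative_tjac diff
          bounded_linear.has_derivative[OF matrix_vector_mul_bounded_linear] has_derivative_ident)
    then show "(?R has_derivative ?R' u) (at u within closed_segment z y)"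
      by (rule has_derivative_at_withinI)
    show "onorm (?R' u) \<le> B"
    proof (rule onorm_le)
      fix k
      have "?R' u k = transpose (tjac F u - tjac F z) *v k"
        by (simp add: transpose_def matrix_vector_mult_def vec_eq_iff left_diff_distrib sum_subtractf)
      also have "norm \<dots> \<le> norm (mat_op (tjac F u - tjac F z)) * norm k"
        by (rule norm_transpose_matrix_vector_mult_le)
      also have "\<dots> \<le> B * norm k"
        using B[OF u] by (intro mult_right_mono) (simp_all add: mat_op_diff dist_norm)
      finally show "norm (?R' u k) \<le> B * norm k" .
    qed
  qed auto
  then show ?thesis by (simp add: matrix_vector_mult_diff_distrib algebra_simps del: transpose_matrix_vector)
qed

section \<open>The Lagrange multiplier rule at points of full rank\<close>

text \<open>A quantitative solvability result. Minimize the exact penalty \<open>|c u| + \<kappa> |u - w|\<close> over the ball.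
Comparison with the centre \<open>w\<close> places the minimizer in the open ball and gives the claimed
distance. If \<open>c u \<noteq> 0\<close> there, then along \<open>- J u (c u)\<close>, with \<open>J u\<close> the transposed Jacobian, the
term \<open>|c u|\<close> decreases at a rate of at least \<open>s\<close> per unit length, while the other term grows at a
rate of at most \<open>\<kappa> < s\<close>.\<close>
lemma exact_root_near:
  fixes c :: "real^'n \<Rightarrow> real^'p"
  assumes diff: "\<And>u. c differentiable (at u)"
    and \<kappa>: "0 < \<kappa>" "\<kappa> < s"
    and below: "\<And>u v. u \<in> cball w R \<Longrightarrow> s * norm v \<le> norm (tjac c u *v v)"
    and small: "norm (c w) < \<kappa> * R"
  obtains u where "c u = 0" "\<kappa> * norm (u - w) \<le> norm (c w)"
proof -
  let ?\<phi> = "\<lambda>u. norm (c u) + \<kappa> * norm (u - w)"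
  have "0 < \<kappa> * R" using small norm_ge_zero[of "c w"] by linarith
  then have R: "R > 0" using \<kappa> by (simp add: zero_less_mult_iff)
  have cont: "continuous_on S c" for S
    by (simp add: continuous_at_imp_continuous_on diff differentiable_imp_continuous_within)
  have "\<exists>u\<in>cball w R. \<forall>u'\<in>cball w R. ?\<phi> u \<le> ?\<phi> u'"
    using R by (intro continuous_attains_inf continuous_intros cont) auto
  then obtain u where u: "u \<in> cball w R" and min: "\<And>u'. u' \<in> cball w R \<Longrightarrow> ?\<phi> u \<le> ?\<phi> u'"
    by blast
  have le: "?\<phi> u \<le> norm (c w)" using min[of w] R by simp
  then have near: "\<kappa> * norm (u - w) \<le> norm (c w)" using norm_ge_zero[of "c u"] by linarith
  then have "\<kappa> * norm (u - w) < \<kappa> * R" using small by linarith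
  then have inside: "norm (u - w) < R" using \<kappa> by simp
  have "c u = 0"
  proof (rule ccontr)
    assume cu: "c u \<noteq> 0"
    define v where "v = - (tjac c u *v c u)"
    have v: "s * norm (c u) \<le> norm v" using below[OF u] by (simp add: v_def)
    have "0 < s * norm (c u)" using \<kappa> cu by simp
    then have v0: "norm v > 0" using v by linarith
    \<comment> \<open>Up to a constant, \<open>?q\<close> majorizes the penalty along the ray from \<open>u\<close> in direction \<open>v\<close>.\<close>
    let ?q = "\<lambda>t. norm (c (u + t *\<^sub>R v)) + \<kappa> * (t * norm v)"
    define l where "l = (c u \<bullet> (transpose (tjac c u) *v v)) / norm (c u) + \<kappa> * norm v"
    have line: "((\<lambda>t. c (u + t *\<^sub>R v)) has_derivative (\<lambda>t. transpose (tjac c u) *v (t *\<^sub>R v))) (at 0)"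
    proof (rule has_derivative_compose[where f = "\<lambda>t. u + t *\<^sub>R v" and g = c])
      show "((\<lambda>t. u + t *\<^sub>R v) has_derivative (\<lambda>t. t *\<^sub>R v)) (at 0)"
        by (auto intro!: derivative_eq_intros)
      show "(c has_derivative (\<lambda>k. transpose (tjac c u) *v k)) (at (u + 0 *\<^sub>R v))"
        using has_derivative_tjac[OF diff] by simp
    qed
    have "((\<lambda>t. norm (c (u + t *\<^sub>R v))) has_derivative
        (\<lambda>t. (transpose (tjac c u) *v (t *\<^sub>R v)) \<bullet> sgn (c (u + 0 *\<^sub>R v)))) (at 0)"
      by (rule has_derivative_compose[OF line]) (use cu in \<open>simp add: has_derivative_norm\<close>)
    then have "DERIV (\<lambda>t. norm (c (u + t *\<^sub>R v))) 0 :>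
        (c u \<bullet> (transpose (tjac c u) *v v)) / norm (c u)"
      unfolding has_field_derivative_def
    proof (rule has_derivative_eq_rhs)
      show "(\<lambda>t. (transpose (tjac c u) *v (t *\<^sub>R v)) \<bullet> sgn (c (u + 0 *\<^sub>R v)))
          = (*) ((c u \<bullet> (transpose (tjac c u) *v v)) / norm (c u))"
        by (simp add: fun_eq_iff matrix_vector_mult_scaleR sgn_div_norm inner_commute field_simps
            del: transpose_matrix_vector)
    qed
    then have der: "DERIV ?q 0 :> l"
      unfolding l_def by (auto intro!: derivative_eq_intros)
    have "c u \<bullet> (transpose (tjac c u) *v v) = - (norm v * norm v)"
      unfolding inner_commute[of "c u"] inner_transpose_matrix_vector
      by (simp add: v_def flip: power2_norm_eq_inner power2_eq_square)
    then have "l = norm v * (\<kappa> - norm v / norm (c u))"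
      unfolding l_def by (simp add: algebra_simps)
    moreover have "s \<le> norm v / norm (c u)" using v cu by (simp add: pos_le_divide_eq)
    ultimately have "l < 0" using \<kappa> v0 by (simp add: mult_less_0_iff)
    then obtain \<delta> where \<delta>: "\<delta> > 0" "\<And>h. 0 < h \<Longrightarrow> h < \<delta> \<Longrightarrow> ?q 0 > ?q (0 + h)"
      using DERIV_neg_dec_right[OF der] by blast
    define h where "h = min (\<delta> / 2) ((R - norm (u - w)) / (norm v))"
    have h: "0 < h" "h < \<delta>" "h * norm v \<le> R - norm (u - w)"
      using \<delta>(1) inside v0 by (auto simp: h_def min_def field_simps)
    have tri: "norm (u + h *\<^sub>R v - w) \<le> norm (u - w) + h * norm v"
      using norm_triangle_ineq[of "u - w" "h *\<^sub>R v"] h(1) by (simp add: algebra_simps)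
    then have "u + h *\<^sub>R v \<in> cball w R" using h(3) by (simp add: dist_norm norm_minus_commute)
    then have "?\<phi> u \<le> ?\<phi> (u + h *\<^sub>R v)" by (rule min)
    also have "\<dots> \<le> ?q h + \<kappa> * norm (u - w)"
      using mult_left_mono[OF tri, of \<kappa>] \<kappa> by (simp add: algebra_simps)
    also have "\<dots> < ?\<phi> u" using \<delta>(2)[OF h(1,2)] by simp
    finally show False by simp
  qed
  then show ?thesis using near by (rule that)
qed

text \<open>At a point of full rank the tangent cone of \<open>{c = 0}\<close> contains the whole kernel of \<open>J^T\<close>. By
differentiability the constraint violation at \<open>z + t d\<close> is \<open>o(t)\<close>, and by the preceding lemma it
can be repaired by a move of comparable length. The lower bound required there persists near \<open>z\<close>
because the Jacobian is continuous at \<open>z\<close>.\<close>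
lemma kernel_directions_are_tangent:
  fixes c :: "real^'n \<Rightarrow> real^'p"
  assumes diff: "\<And>u. c differentiable (at u)"
    and cont: "isCont (\<lambda>u. mat_op (tjac c u)) z"
    and rank: "rank (tjac c z) = CARD('p)"
    and cz: "c z = 0" and ker: "transpose (tjac c z) *v d = 0" and e: "0 < e"
  obtains \<delta> where "0 < \<delta>"
    and "\<And>t. 0 < t \<Longrightarrow> t < \<delta> \<Longrightarrow> \<exists>w. c w = 0 \<and> norm (w - (z + t *\<^sub>R d)) \<le> e * t"
proof -
  define s where "s = sigma_min (tjac c z)"
  have s: "0 < s" unfolding s_def by (rule sigma_min_pos[OF rank])
  obtain r where r: "0 < r"
    and r': "\<And>u. dist u z < r \<Longrightarrow> dist (mat_op (tjac c u)) (mat_op (tjac c z)) < s / 2"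
    using cont s unfolding continuous_at_eps_delta by (metis half_gt_zero)
  have below: "(s / 2) * norm v \<le> norm (tjac c u *v v)" if "dist u z < r" for u v
  proof -
    have "(s / 2) * norm v \<le> (s - dist (mat_op (tjac c u)) (mat_op (tjac c z))) * norm v"
      using r'[OF that] by (intro mult_right_mono) auto
    also have "\<dots> \<le> norm (tjac c u *v v)"
      by (rule bounded_below_perturb) (simp add: s_def sigma_min_le)
    finally show ?thesis .
  qed
  define \<kappa> where "\<kappa> = s / 4"
  \<comment> \<open>This linearization accuracy turns into a violation of at most \<open>\<kappa> e t\<close> at \<open>z + t d\<close>.\<close>
  define e' where "e' = \<kappa> * e / (norm d + 1)"
  have e': "0 < e'" using e s by (simp add: e'_def \<kappa>_def add_nonneg_pos)
  obtain r2 where r2: "0 < r2"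
    and lin: "\<And>y. norm (y - z) < r2 \<Longrightarrow>
      norm (c y - c z - transpose (tjac c z) *v (y - z)) \<le> e' * norm (y - z)"
    using has_derivative_tjac[OF diff, of z] e' unfolding has_derivative_at_alt by blast
  \<comment> \<open>The three bounds keep \<open>z + t d\<close> where the linearization holds, keep the ball of radius \<open>r / 2\<close>
    around it where the Jacobian is bounded below, and make the repair shorter than \<open>r / 2\<close>.\<close>
  define \<delta> where "\<delta> = min (r2 / (norm d + 1)) (min (r / (2 * (norm d + 1))) (r / (4 * e)))"
  have nd: "0 < norm d + 1" by (simp add: add_nonneg_pos)
  have "0 < \<delta>" using r r2 e nd by (simp add: \<delta>_def)
  moreover have "\<exists>w. c w = 0 \<and> norm (w - (z + t *\<^sub>R d)) \<le> e * t" if t: "0 < t" "t < \<delta>" for t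
  proof -
    let ?w = "z + t *\<^sub>R d"
    have "t * (norm d + 1) < r2" "t * (norm d + 1) < r / 2" "t * e < r / 4"
      using t(2) nd e by (simp_all add: \<delta>_def field_simps)
    then have td: "t * norm d < r2" "t * norm d < r / 2" "t * e < r / 4"
      using t(1) by (simp_all add: distrib_left)
    have "norm (c ?w) \<le> e' * (t * norm d)"
      using lin[of ?w] td(1) t(1) cz ker
      by (simp add: matrix_vector_mult_scaleR del: transpose_matrix_vector)
    also have "\<dots> \<le> e' * (t * (norm d + 1))"
      using t e' by (intro mult_left_mono) auto
    also have "\<dots> = \<kappa> * (e * t)" using nd by (simp add: e'_def)
    finally have cw: "norm (c ?w) \<le> \<kappa> * (e * t)" .
    obtain u where u: "c u = 0" "\<kappa> * norm (u - ?w) \<le> norm (c ?w)"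
    proof (rule exact_root_near[OF diff, of \<kappa> "s / 2" ?w "r / 2"])
      show "0 < \<kappa>" "\<kappa> < s / 2" using s by (auto simp: \<kappa>_def)
      show "s / 2 * norm v \<le> norm (tjac c u *v v)" if u: "u \<in> cball ?w (r / 2)" for u v
      proof (rule below)
        have "dist u z \<le> dist u ?w + dist ?w z" by (rule dist_triangle)
        also have "dist u ?w \<le> r / 2" using u by (simp add: dist_commute)
        also have "dist ?w z < r / 2" using td(2) t(1) by (simp add: dist_norm)
        finally show "dist u z < r" by simp
      qed
      have "\<kappa> * (e * t) < \<kappa> * (r / 2)"
        using td(3) r s by (intro mult_strict_left_mono) (auto simp: \<kappa>_def mult.commute)
      then show "norm (c ?w) < \<kappa> * (r / 2)" using cw by linarith
    qed
    have "\<kappa> * norm (u - ?w) \<le> \<kappa> * (e * t)" using u cw by linarith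
    then have "norm (u - ?w) \<le> e * t" using s by (simp add: \<kappa>_def)
    then show ?thesis using u by blast
  qed
  ultimately show ?thesis by (rule that)
qed

text \<open>If \<open>F' d = -a < 0\<close>, then moving along the feasible set in the tangent direction \<open>d\<close> decreases \<open>F\<close>
by about \<open>a t\<close>. The tolerances \<open>e\<close> (distance of the feasible point from \<open>z + t d\<close>) and \<open>e1\<close>
(linearization of \<open>F\<close>) are chosen so that each destroys at most a quarter of that decrease.\<close>
lemma derivative_nonneg_on_kernel:
  fixes c :: "real^'n \<Rightarrow> real^'p" and F :: "real^'n \<Rightarrow> real"
  assumes diff: "\<And>u. c differentiable (at u)"
    and cont: "isCont (\<lambda>u. mat_op (tjac c u)) z"
    and rank: "rank (tjac c z) = CARD('p)"
    and cz: "c z = 0" and ker: "transpose (tjac c z) *v d = 0"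
    and F': "(F has_derivative F') (at z)"
    and min: "\<And>w. c w = 0 \<Longrightarrow> F z \<le> F w"
  shows "0 \<le> F' d"
proof (rule ccontr)
  assume "\<not> 0 \<le> F' d"
  define a where "a = - F' d"
  have a: "a > 0" using \<open>\<not> 0 \<le> F' d\<close> by (simp add: a_def)
  have lin: "bounded_linear F'" using F' by (rule has_derivative_bounded_linear)
  obtain B where B: "0 < B" "\<And>r. norm (F' r) \<le> norm r * B"
    using bounded_linear.pos_bounded[OF lin] by blast
  define e where "e = min 1 (a / (4 * B))"
  have e: "0 < e" "e \<le> 1" "B * e \<le> a / 4" using a B(1) by (auto simp: e_def min_def field_simps)
  have nd: "0 < norm d + 1" by (simp add: add_nonneg_pos)
  define e1 where "e1 = a / (4 * (norm d + 1))"
  have e1: "0 < e1" using a nd by (simp add: e1_def)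
  have a_eq: "a = 4 * (e1 * (norm d + 1))"
    unfolding e1_def using nd by (simp add: field_simps)
  obtain r where r: "0 < r"
    and app: "\<And>y. norm (y - z) < r \<Longrightarrow> norm (F y - F z - F' (y - z)) \<le> e1 * norm (y - z)"
    using F' e1 unfolding has_derivative_at_alt by blast
  obtain \<delta> where \<delta>: "0 < \<delta>"
    and near: "\<And>t. 0 < t \<Longrightarrow> t < \<delta> \<Longrightarrow> \<exists>w. c w = 0 \<and> norm (w - (z + t *\<^sub>R d)) \<le> e * t"
    using kernel_directions_are_tangent[OF diff cont rank cz ker e(1)] by blast
  define t where "t = min (\<delta> / 2) (r / (2 * (norm d + 1)))"
  have "t \<le> \<delta> / 2" unfolding t_def by (rule min.cobounded1)
  moreover have "0 < t" using \<delta> r nd by (simp add: t_def)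
  ultimately have t: "0 < t" "t < \<delta>" using \<delta> by auto
  have "t \<le> r / (2 * (norm d + 1))" by (simp add: t_def)
  then have "t * (norm d + 1) \<le> r / 2" using nd by (simp add: field_simps)
  then have tr: "t * (norm d + 1) < r" using r by linarith
  obtain w where w: "c w = 0" "norm (w - (z + t *\<^sub>R d)) \<le> e * t" using near[OF t] by blast
  define q where "q = w - (z + t *\<^sub>R d)"
  have wz: "w - z = t *\<^sub>R d + q" by (simp add: q_def)
  have "e * t \<le> 1 * t" using e t by (intro mult_right_mono) auto
  then have "norm q \<le> t" using w(2) by (simp add: q_def)
  then have nwz: "norm (w - z) \<le> t * (norm d + 1)"
    using norm_triangle_ineq[of "t *\<^sub>R d" q] t by (simp add: wz distrib_left)
  have "norm q * B \<le> (e * t) * B" using w(2) B(1) by (intro mult_right_mono) (auto simp: q_def)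
  also have "\<dots> = (B * e) * t" by simp
  also have "\<dots> \<le> (a / 4) * t" using e t by (intro mult_right_mono) auto
  finally have "F' q \<le> (a / 4) * t" using B(2)[of q] by simp
  moreover have "F' (w - z) = t * F' d + F' q"
    unfolding wz by (simp add: linear_add linear_scale bounded_linear.linear[OF lin])
  ultimately have "F' (w - z) \<le> - (a * t) + (a / 4) * t"
    by (simp add: a_def mult.commute)
  moreover have "e1 * norm (w - z) \<le> e1 * (t * (norm d + 1))"
    using nwz e1 by (intro mult_left_mono) auto
  moreover have "e1 * (t * (norm d + 1)) = (a / 4) * t"
    by (simp add: a_eq)
  moreover have "F w - F z - F' (w - z) \<le> e1 * norm (w - z)"
    using app[of w] nwz tr by simp
  ultimately have "F w - F z \<le> - (a * t) + (a / 4) * t + (a / 4) * t" by linarith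
  moreover have "a * t > 0" using a t by simp
  ultimately have "F w < F z" by simp
  then show False using min[OF w(1)] by simp
qed

text \<open>Since the kernel is symmetric, this is the Lagrange multiplier rule in dual form. It serves below
for the components of the constraint-preserving map and for the squared distance to a point.\<close>
lemma derivative_zero_on_kernel:
  fixes c :: "real^'n \<Rightarrow> real^'p" and F :: "real^'n \<Rightarrow> real"
  assumes diff: "\<And>u. c differentiable (at u)"
    and cont: "isCont (\<lambda>u. mat_op (tjac c u)) z"
    and rank: "rank (tjac c z) = CARD('p)"
    and cz: "c z = 0" and ker: "transpose (tjac c z) *v d = 0"
    and F': "(F has_derivative F') (at z)"
    and min: "\<And>w. c w = 0 \<Longrightarrow> F z \<le> F w"
  shows "F' d = 0"
proof -
  have "transpose (tjac c z) *v (- d) = 0"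
    using ker by (simp add: linear_neg[OF matrix_vector_mul_linear] del: transpose_matrix_vector)
  then have "0 \<le> F' (- d)"
    by (intro derivative_nonneg_on_kernel[OF diff cont rank cz _ F' min])
  moreover have "F' (- d) = - F' d"
    using F' by (simp add: has_derivative_linear linear_neg)
  moreover have "0 \<le> F' d" by (rule derivative_nonneg_on_kernel[OF diff cont rank cz ker F' min])
  ultimately show ?thesis by simp
qed

text \<open>Every linear functional of \<open>A w - w\<close> is constant on the feasible set, so its derivative vanishes
on the tangent space. The functional is taken to be the inner product with the value that is to
be shown zero.\<close>
lemma retraction_derivative_fixes_kernel:
  fixes c :: "real^'n \<Rightarrow> real^'p" and A :: "real^'n \<Rightarrow> real^'n"
  assumes diff: "\<And>u. c differentiable (at u)"
    and cont: "isCont (\<lambda>u. mat_op (tjac c u)) z"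
    and rank: "rank (tjac c z) = CARD('p)"
    and cz: "c z = 0" and ker: "transpose (tjac c z) *v d = 0"
    and A: "A differentiable (at z)" and fix_A: "\<And>w. c w = 0 \<Longrightarrow> A w = w"
  shows "transpose (tjac A z) *v d = d"
proof -
  let ?b = "transpose (tjac A z) *v d - d"
  have "((\<lambda>w. (A w - w) \<bullet> ?b) has_derivative (\<lambda>k. (transpose (tjac A z) *v k - k) \<bullet> ?b)) (at z)"
    by (intro has_derivative_inner_left has_derivative_diff has_derivative_tjac A has_derivative_ident)
  then have "?b \<bullet> ?b = 0"
    by (rule derivative_zero_on_kernel[OF diff cont rank cz ker]) (simp add: fix_A cz)
  then show ?thesis by simp
qed

text \<open>The Lagrange rule for the squared distance to \<open>y\<close>, whose gradient at \<open>z\<close> is \<open>2 (z - y)\<close>.\<close>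
lemma closest_point_orthogonal_to_kernel:
  fixes c :: "real^'n \<Rightarrow> real^'p"
  assumes diff: "\<And>u. c differentiable (at u)"
    and cont: "isCont (\<lambda>u. mat_op (tjac c u)) z"
    and rank: "rank (tjac c z) = CARD('p)"
    and cz: "c z = 0" and ker: "transpose (tjac c z) *v d = 0"
    and closest: "\<And>w. c w = 0 \<Longrightarrow> dist y z \<le> dist y w"
  shows "(y - z) \<bullet> d = 0"
proof -
  have "((\<lambda>w. (w - y) \<bullet> (w - y)) has_derivative (\<lambda>k. (z - y) \<bullet> k + k \<bullet> (z - y))) (at z)"
    by (auto intro!: derivative_eq_intros)
  then have "(z - y) \<bullet> d + d \<bullet> (z - y) = 0"
  proof (rule derivative_zero_on_kernel[OF diff cont rank cz ker])
    fix w assume "c w = 0"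
    then have "(dist y z)\<^sup>2 \<le> (dist y w)\<^sup>2" by (intro power_mono closest) auto
    then show "(z - y) \<bullet> (z - y) \<le> (w - y) \<bullet> (w - y)"
      by (simp only: dist_norm norm_minus_commute[of y] power2_norm_eq_inner)
  qed
  then show ?thesis by (simp add: inner_commute inner_diff_right)
qed

section \<open>The penalty function\<close>

lemma GDERIV_cdf_fun:
  fixes f :: "real^'n \<Rightarrow> real" and c :: "real^'n \<Rightarrow> real^'p" and A :: "real^'n \<Rightarrow> real^'n"
  assumes f: "f differentiable (at (A y))" and c: "c differentiable (at y)"
    and A: "A differentiable (at y)"
  shows "GDERIV (cdf_fun f c A \<beta>) y :>
    tjac A y *v grad f (A y) + \<beta> *\<^sub>R (tjac c y *v c y)"
proof -
  have fA: "((\<lambda>u. f (A u)) has_derivative (\<lambda>k. (transpose (tjac A y) *v k) \<bullet> grad f (A y))) (at y)"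
    using has_derivative_compose[OF has_derivative_tjac[OF A]] GDERIV_grad[OF f]
    unfolding gderiv_def by fast
  have cc: "((\<lambda>u. c u \<bullet> c u) has_derivative
      (\<lambda>k. c y \<bullet> (transpose (tjac c y) *v k) + (transpose (tjac c y) *v k) \<bullet> c y)) (at y)"
    by (intro has_derivative_inner has_derivative_tjac c)
  have "((\<lambda>u. f (A u) + \<beta> / 2 * (c u \<bullet> c u)) has_derivative
      (\<lambda>k. (transpose (tjac A y) *v k) \<bullet> grad f (A y) +
        \<beta> / 2 * (c y \<bullet> (transpose (tjac c y) *v k) + (transpose (tjac c y) *v k) \<bullet> c y))) (at y)"
    by (intro has_derivative_add has_derivative_mult_right fA cc)
  also have "(\<lambda>u. f (A u) + \<beta> / 2 * (c u \<bullet> c u)) = cdf_fun f c A \<beta>"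
    by (simp add: cdf_fun_def fun_eq_iff power2_norm_eq_inner)
  also have "(\<lambda>k. (transpose (tjac A y) *v k) \<bullet> grad f (A y) +
        \<beta> / 2 * (c y \<bullet> (transpose (tjac c y) *v k) + (transpose (tjac c y) *v k) \<bullet> c y))
      = (\<lambda>k. k \<bullet> (tjac A y *v grad f (A y) + \<beta> *\<^sub>R (tjac c y *v c y)))"
    unfolding inner_commute[of "c y"] inner_transpose_matrix_vector
    by (simp add: fun_eq_iff inner_add_right)
  finally show ?thesis unfolding gderiv_def .
qed

text \<open>The range of \<open>P^T\<close> lies in the kernel of \<open>J^T\<close>, because \<open>J^T P^T = (P J)^T = 0\<close>, and \<open>P^T\<close> fixes
that kernel pointwise. So \<open>P^T\<close>, and with it \<open>P\<close>, is a projection.\<close>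
lemma idempotent_if_transpose_fixes_kernel:
  fixes P :: "real^'n^'n" and J :: "real^'p^'n"
  assumes PJ: "P ** J = 0"
    and fix_P: "\<And>d. transpose J *v d = 0 \<Longrightarrow> transpose P *v d = d"
  shows "P *v (P *v v) = P *v v"
proof (subst vector_eq_ldot[symmetric], intro allI)
  fix u
  have "transpose J *v (transpose P *v u) = transpose (P ** J) *v u"
    by (simp only: matrix_transpose_mul matrix_vector_mul_assoc)
  also have "\<dots> = 0"
    unfolding PJ by (simp add: transpose_def matrix_vector_mult_def vec_eq_iff)
  finally have "transpose P *v (transpose P *v u) = transpose P *v u" by (rule fix_P)
  then show "u \<bullet> (P *v (P *v v)) = u \<bullet> (P *v v)"
    by (metis inner_transpose_matrix_vector)
qed

text \<open>Here \<open>P\<close> and \<open>J\<close> are the transposed Jacobians of the constraint-preserving map and of the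
constraints at a feasible point, and \<open>Q\<close> and \<open>N\<close> are those at a nearby point, so that
\<open>Q g + \<beta> N v\<close> is the gradient of the penalty function. The complementary projection \<open>I - P\<close>
annihilates \<open>P\<close> and fixes the columns of \<open>J\<close>. Hence it removes the objective up to the variation
\<open>Q - P\<close> and keeps the penalty term up to the variation \<open>N - J\<close>. Its norm is at most \<open>K\<close>.\<close>
lemma norm_projected_sum_lower_bound:
  fixes P Q :: "real^'n^'n" and J N :: "real^'p^'n"
  assumes idem: "\<And>v. P *v (P *v v) = P *v v" and PJ: "P ** J = 0"
    and P: "norm (mat_op P) + 1 \<le> K" and \<beta>: "0 \<le> \<beta>"
    and Q: "dist (mat_op Q) (mat_op P) \<le> a" and N: "dist (mat_op N) (mat_op J) \<le> b"
    and J: "\<And>l. s * norm l \<le> norm (J *v l)"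
  shows "\<beta> * (s - K * b) * norm v - K * a * norm g \<le> K * norm (Q *v g + \<beta> *\<^sub>R (N *v v))"
proof -
  define T where "T = (\<lambda>u. u - P *v u)"
  have T_add: "T (u + w) = T u + T w" for u w
    by (simp add: T_def matrix_vector_right_distrib)
  have T_scale: "T (t *\<^sub>R u) = t *\<^sub>R T u" for t u
    by (simp add: T_def matrix_vector_mult_scaleR scaleR_diff_right)
  have T_bound: "norm (T u) \<le> K * norm u" for u
  proof -
    have "norm (T u) \<le> norm u + norm (P *v u)" unfolding T_def by (rule norm_triangle_ineq4)
    also have "\<dots> \<le> (norm (mat_op P) + 1) * norm u"
      using norm_matrix_vector_mult_le[of P u] by (simp add: distrib_right)
    also have "\<dots> \<le> K * norm u" using P by (intro mult_right_mono) auto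
    finally show ?thesis .
  qed
  have K: "0 \<le> K" using P norm_ge_zero[of "mat_op P"] by linarith
  have TP: "T (P *v u) = 0" for u by (simp add: T_def idem)
  have TJ: "T (J *v v) = J *v v" by (simp add: T_def matrix_vector_mul_assoc PJ)
  have "Q *v g + \<beta> *\<^sub>R (N *v v)
      = (Q *v g - P *v g) + P *v g + \<beta> *\<^sub>R (J *v v) + \<beta> *\<^sub>R (N *v v - J *v v)"
    by (simp add: scaleR_diff_right)
  then have "T (Q *v g + \<beta> *\<^sub>R (N *v v))
      = T (Q *v g - P *v g) + \<beta> *\<^sub>R (J *v v) + \<beta> *\<^sub>R T (N *v v - J *v v)"
    by (simp only: T_add T_scale TP TJ add_0_right)
  then have "\<beta> *\<^sub>R (J *v v) = T (Q *v g + \<beta> *\<^sub>R (N *v v))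
      - T (Q *v g - P *v g) - \<beta> *\<^sub>R T (N *v v - J *v v)"
    by simp
  then have "norm (\<beta> *\<^sub>R (J *v v)) \<le> norm (T (Q *v g + \<beta> *\<^sub>R (N *v v)))
      + norm (T (Q *v g - P *v g)) + norm (\<beta> *\<^sub>R T (N *v v - J *v v))"
    using norm_triangle_ineq4 by (smt (verit))
  moreover have "\<beta> * (s * norm v) \<le> norm (\<beta> *\<^sub>R (J *v v))"
    using J[of v] \<beta> by (simp add: mult_left_mono)
  moreover have "norm (T (Q *v g - P *v g)) \<le> K * (a * norm g)"
  proof -
    have "norm (Q *v g - P *v g) \<le> a * norm g"
      using norm_matrix_diff_vector_mult_le[of Q g P] mult_right_mono[OF Q, of "norm g"] by simp
    then show ?thesis using T_bound K by (meson mult_left_mono order_trans)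
  qed
  moreover have "norm (\<beta> *\<^sub>R T (N *v v - J *v v)) \<le> \<beta> * (K * (b * norm v))"
  proof -
    have "norm (N *v v - J *v v) \<le> b * norm v"
      using norm_matrix_diff_vector_mult_le[of N v J] mult_right_mono[OF N, of "norm v"] by simp
    then have "norm (T (N *v v - J *v v)) \<le> K * (b * norm v)"
      using T_bound K by (meson mult_left_mono order_trans)
    then show ?thesis using \<beta> by (simp add: mult_left_mono)
  qed
  ultimately show ?thesis
    using T_bound[of "Q *v g + \<beta> *\<^sub>R (N *v v)"] by (simp add: algebra_simps)
qed

section \<open>The gradient bound and stationary points\<close>

lemma norm_le_SUP:
  assumes "continuous_on S F" "compact S" "y \<in> S"
  shows "norm (F y) \<le> (SUP u\<in>S. norm (F u))"
proof (rule cSUP_upper[OF assms(3)])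
  show "bdd_above ((\<lambda>u. norm (F u)) ` S)"
    by (intro bounded_imp_bdd_above compact_imp_bounded compact_continuous_image
        continuous_on_norm assms)
qed

lemma Theta_eq_cball: "Theta c x = cball x (rho c x)"
  by (auto simp: Theta_def dist_norm norm_minus_commute)

lemma le_div_or_topD:
  assumes "ereal r \<le> div_or_top a b" "0 \<le> a" "0 \<le> b"
  shows "b * r \<le> a"
  using assms by (cases "b = 0") (auto simp: div_or_top_def field_simps)

text \<open>Linearize at the feasible point \<open>z\<close> closest to \<open>y\<close>. As \<open>|z - y| \<le> |x - y|\<close>, the point \<open>z\<close> is within
\<open>2 |y - x| \<le> \<rho>\<^sub>x\<close> of \<open>x\<close>, so all constants that belong to \<open>\<Theta>\<^sub>x\<close> are available on the segment from
\<open>z\<close> to \<open>y\<close>. Since \<open>y - z\<close> is normal to the feasible set, \<open>|c y|\<close> controls \<open>|y - z|\<close>. With this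
error bound, the threshold on \<open>\<beta>\<close> makes the contribution of the objective that survives \<open>I - P\<close> at
most \<open>\<beta> \<sigma> |c y| / 8\<close>, whereas the penalty contributes at least \<open>29/32 \<beta> \<sigma> |c y|\<close>.\<close>
lemma cdf_grad_lower_bound:
  fixes f :: "real^'n \<Rightarrow> real" and c :: "real^'n \<Rightarrow> real^'p" and A :: "real^'n \<Rightarrow> real^'n"
  assumes f_diff: "\<And>z. f differentiable (at z)"
    and c_diff: "\<And>z. c differentiable (at z)"
    and A_diff: "\<And>z. A differentiable (at z)"
    and grad_f_lip: "locally_lipschitz (grad f)"
    and Jc_lip: "locally_lipschitz (\<lambda>z. mat_op (tjac c z))"
    and JA_lip: "locally_lipschitz (\<lambda>z. mat_op (tjac A z))"
    and Jc_full_rank: "\<And>z. z \<in> feasible c \<Longrightarrow> rank (tjac c z) = CARD('p)"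
    and A_fix: "\<And>z. z \<in> feasible c \<Longrightarrow> A z = z"
    and JA_Jc: "\<And>z. z \<in> feasible c \<Longrightarrow> tjac A z ** tjac c z = 0"
    and beta_pos: "\<beta> > 0"
    and x_feasible: "x \<in> feasible c"
    and beta_ge: "\<beta> \<ge> beta_thr f c A x"
    and y: "y \<in> Omega c A x"
  shows "\<beta> * sigma_c c x / (8 * (M_A c A x + 1)) * norm (c y)
    \<le> norm (grad (cdf_fun f c A \<beta>) y)"
proof (cases "c y = 0")
  case False
  define K where "K = M_A c A x + 1"
  define \<sigma> where "\<sigma> = sigma_c c x"
  define \<delta> where "\<delta> = norm (y - x)"
  have cx: "c x = 0" using x_feasible by (simp add: feasible_def)
  \<comment> \<open>Two distinct points of \<open>\<Theta>\<^sub>x\<close> are what makes the Lipschitz moduli nonnegative: otherwise they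
    would be suprema over the empty set.\<close>
  have xy: "x \<noteq> y" using False cx by auto
  have \<sigma>: "0 < \<sigma>"
    unfolding \<sigma>_def sigma_c_def by (rule sigma_min_pos[OF Jc_full_rank[OF x_feasible]])
  have cont: "isCont (\<lambda>u. mat_op (tjac c u)) z" for z
    using locally_lipschitz_imp_continuous_on[OF Jc_lip, of UNIV]
    by (simp add: continuous_on_eq_continuous_at)
  have compact: "compact (Theta c x)" by (simp add: Theta_eq_cball)

  have eps: "ereal \<delta> \<le> ereal (rho c x / 2)"
    "ereal \<delta> \<le> div_or_top \<sigma> (32 * L_c c x * K)"
    using y by (auto simp: Omega_def eps_def \<delta>_def \<sigma>_def K_def)
  have \<delta>_rho: "2 * \<delta> \<le> rho c x" using eps(1) by simp
  have in_Theta: "u \<in> Theta c x" if "norm (u - x) \<le> 2 * \<delta>" for u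
    using that \<delta>_rho by (simp add: Theta_def)
  have xT: "x \<in> Theta c x" and yT: "y \<in> Theta c x"
    by (auto intro!: in_Theta simp: \<delta>_def)

  have lip_c: "dist (mat_op (tjac c u)) (mat_op (tjac c w)) \<le> L_c c x * dist u w"
    if "u \<in> Theta c x" "w \<in> Theta c x" for u w
    unfolding L_c_def by (rule dist_le_least_lipschitz[OF Jc_lip compact that])
  have lip_A: "dist (mat_op (tjac A u)) (mat_op (tjac A w)) \<le> L_A c A x * dist u w"
    if "u \<in> Theta c x" "w \<in> Theta c x" for u w
    unfolding L_A_def by (rule dist_le_least_lipschitz[OF JA_lip compact that])
  have nonneg: "0 \<le> L" if "r \<le> L * dist y x" "0 \<le> r" for r L :: real
    using order_trans[OF that(2,1)] xy by (simp add: zero_le_mult_iff)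
  have Lc: "0 \<le> L_c c x" by (rule nonneg[OF lip_c[OF yT xT]]) simp
  have LA: "0 \<le> L_A c A x" by (rule nonneg[OF lip_A[OF yT xT]]) simp
  have MA: "norm (mat_op (tjac A u)) \<le> M_A c A x" if "u \<in> Theta c x" for u
    unfolding M_A_def
    by (rule norm_le_SUP[OF locally_lipschitz_imp_continuous_on[OF JA_lip] compact that])
  have K: "1 \<le> K" using order_trans[OF norm_ge_zero MA[OF xT]] by (simp add: K_def)
  have "continuous_on (Theta c x) (\<lambda>u. grad f (A u))"
    by (rule continuous_on_compose2[OF locally_lipschitz_imp_continuous_on[OF grad_f_lip, of UNIV]])
       (simp_all add: A_diff continuous_at_imp_continuous_on differentiable_imp_continuous_within)
  then have Mf: "norm (grad f (A y)) \<le> M_f f c A x"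
    unfolding M_f_def by (rule norm_le_SUP[OF _ compact yT])
  then have Mf0: "0 \<le> M_f f c A x" using norm_ge_zero order_trans by blast
  have KL\<delta>: "32 * (K * (L_c c x * \<delta>)) \<le> \<sigma>"
    using le_div_or_topD[OF eps(2)] \<sigma> Lc K by (simp add: mult_ac)
  have "1 * (L_c c x * \<delta>) \<le> K * (L_c c x * \<delta>)"
    using K Lc by (intro mult_right_mono) (auto simp: \<delta>_def)
  then have L\<delta>: "32 * (L_c c x * \<delta>) \<le> \<sigma>" using KL\<delta> by linarith

  have "closed (feasible c)"
  proof -
    have "continuous_on UNIV c"
      by (simp add: continuous_at_imp_continuous_on c_diff differentiable_imp_continuous_within)
    then show ?thesis
      unfolding feasible_def by (rule closed_Collect_eq) (rule continuous_on_const)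
  qed
  then obtain z where z: "z \<in> feasible c"
    and closest: "\<And>w. w \<in> feasible c \<Longrightarrow> dist y z \<le> dist y w"
    using distance_attains_inf[of "feasible c" y] x_feasible by blast
  have cz: "c z = 0" using z by (simp add: feasible_def)
  note rank_z = Jc_full_rank[OF z]
  define d where "d = norm (y - z)"
  have d: "0 \<le> d" "d \<le> \<delta>"
    using closest[OF x_feasible] by (simp_all add: d_def \<delta>_def dist_norm)
  have "norm (z - x) \<le> norm (z - y) + norm (y - x)"
    using norm_triangle_ineq[of "z - y" "y - x"] by simp
  then have zx: "norm (z - x) \<le> 2 * \<delta>" using d by (simp add: d_def \<delta>_def norm_minus_commute)
  have zT: "z \<in> Theta c x" by (rule in_Theta[OF zx])

  \<comment> \<open>The singular value drops by at most \<open>L |z - x| \<le> 2 L \<delta> \<le> \<sigma> / 16\<close>.\<close>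
  have below: "15 / 16 * \<sigma> * norm l \<le> norm (tjac c z *v l)" for l
  proof -
    have "dist (mat_op (tjac c z)) (mat_op (tjac c x)) \<le> L_c c x * (2 * \<delta>)"
      using order_trans[OF lip_c[OF zT xT]] zx Lc by (simp add: dist_norm mult_left_mono)
    then have "15 / 16 * \<sigma> * norm l
        \<le> (\<sigma> - dist (mat_op (tjac c z)) (mat_op (tjac c x))) * norm l"
      using L\<delta> by (intro mult_right_mono) auto
    also have "\<dots> \<le> norm (tjac c z *v l)"
      by (rule bounded_below_perturb) (simp add: \<sigma>_def sigma_c_def sigma_min_le)
    finally show ?thesis .
  qed

  have "(y - z) \<bullet> k = 0" if "transpose (tjac c z) *v k = 0" for k
    by (rule closest_point_orthogonal_to_kernel[OF c_diff cont rank_z cz that])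
       (simp add: closest feasible_def)
  then obtain l where l: "y - z = tjac c z *v l"
    using in_range_if_orthogonal_to_transpose_kernel[OF rank_z] by blast
  have "15 / 16 * \<sigma> * d \<le> norm (transpose (tjac c z) *v (y - z))"
    unfolding d_def l by (rule transpose_bounded_below_on_range[OF _ below]) (use \<sigma> in simp)
  moreover have "norm (c y - c z - transpose (tjac c z) *v (y - z)) \<le> (L_c c x * \<delta>) * norm (y - z)"
  proof (rule norm_diff_linearization_le[OF c_diff])
    fix u assume u: "u \<in> closed_segment z y"
    have "u \<in> Theta c x"
      using closed_segment_subset[OF zT yT] u convex_cball Theta_eq_cball by (metis subsetD)
    moreover have "dist u z \<le> \<delta>"
      using segment_bound(1)[OF u] d by (simp add: dist_norm d_def)
    ultimately show "dist (mat_op (tjac c u)) (mat_op (tjac c z)) \<le> L_c c x * \<delta>"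
      using order_trans[OF lip_c[OF _ zT]] Lc by (simp add: mult_left_mono)
  qed
  moreover have "norm (transpose (tjac c z) *v (y - z))
      \<le> norm (c y) + norm (c y - c z - transpose (tjac c z) *v (y - z))"
    using norm_triangle_ineq4[of "c y" "c y - c z - transpose (tjac c z) *v (y - z)"]
    by (simp add: cz del: transpose_matrix_vector)
  moreover have "(L_c c x * \<delta>) * d \<le> (\<sigma> / 32) * d"
    using L\<delta> d by (intro mult_right_mono) auto
  moreover have "0 \<le> \<sigma> * d" using \<sigma> d by simp
  \<comment> \<open>The error bound: \<open>(15/16 - 1/32) \<sigma> d \<le> |c y|\<close>, rounded to a factor 2.\<close>
  ultimately have \<sigma>d: "\<sigma> * d \<le> 2 * norm (c y)"
    unfolding d_def by linarith

  have fix_P: "transpose (tjac A z) *v k = k" if "transpose (tjac c z) *v k = 0" for k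
    by (rule retraction_derivative_fixes_kernel[OF c_diff cont rank_z cz that A_diff])
       (simp add: A_fix feasible_def)
  have "\<beta> * (15 / 16 * \<sigma> - K * (L_c c x * \<delta>)) * norm (c y)
      - K * (L_A c A x * d) * norm (grad f (A y))
    \<le> K * norm (tjac A y *v grad f (A y) + \<beta> *\<^sub>R (tjac c y *v c y))"
  proof (rule norm_projected_sum_lower_bound[OF
        idempotent_if_transpose_fixes_kernel[OF JA_Jc[OF z] fix_P] JA_Jc[OF z] _ _ _ _ below])
    show "norm (mat_op (tjac A z)) + 1 \<le> K" using MA[OF zT] by (simp add: K_def)
    show "0 \<le> \<beta>" using beta_pos by simp
    show "dist (mat_op (tjac A y)) (mat_op (tjac A z)) \<le> L_A c A x * d"
      using lip_A[OF yT zT] by (simp add: d_def dist_norm)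
    show "dist (mat_op (tjac c y)) (mat_op (tjac c z)) \<le> L_c c x * \<delta>"
      using order_trans[OF lip_c[OF yT zT]] d Lc by (simp add: d_def dist_norm mult_left_mono)
  qed
  moreover have "\<beta> * (29 / 32 * \<sigma>) * norm (c y)
      \<le> \<beta> * (15 / 16 * \<sigma> - K * (L_c c x * \<delta>)) * norm (c y)"
    using KL\<delta> beta_pos by (intro mult_right_mono mult_left_mono) auto
  moreover have "16 * (K * (L_A c A x * d) * norm (grad f (A y))) \<le> 2 * (\<beta> * \<sigma> * norm (c y))"
  proof -
    have "16 * M_f f c A x * L_A c A x * (2 * M_A c A x + 1) / \<sigma>\<^sup>2 \<le> \<beta>"
      using beta_ge by (simp add: beta_thr_def \<sigma>_def)
    then have thr: "16 * (M_f f c A x * L_A c A x * (2 * M_A c A x + 1)) \<le> \<beta> * \<sigma>\<^sup>2"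
      using \<sigma> by (simp add: pos_divide_le_eq mult_ac)
    have "K * (L_A c A x * d) * norm (grad f (A y)) \<le> K * (L_A c A x * d) * M_f f c A x"
      using K LA d Mf by (intro mult_left_mono) auto
    also have "\<dots> = (M_f f c A x * L_A c A x * K) * d" by simp
    also have "\<dots> \<le> (M_f f c A x * L_A c A x * (2 * M_A c A x + 1)) * d"
      using K LA d Mf0 by (intro mult_right_mono mult_left_mono) (auto simp: K_def)
    finally have "16 * (K * (L_A c A x * d) * norm (grad f (A y)))
        \<le> 16 * (M_f f c A x * L_A c A x * (2 * M_A c A x + 1)) * d" by simp
    also have "\<dots> \<le> (\<beta> * \<sigma>\<^sup>2) * d" using thr d by (intro mult_right_mono) auto
    also have "\<dots> = (\<beta> * \<sigma>) * (\<sigma> * d)" by (simp add: power2_eq_square)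
    also have "\<dots> \<le> (\<beta> * \<sigma>) * (2 * norm (c y))"
      using \<sigma>d \<sigma> beta_pos by (intro mult_left_mono) auto
    finally show ?thesis by (simp add: mult_ac)
  qed
  moreover have "0 \<le> \<beta> * \<sigma> * norm (c y)" using beta_pos \<sigma> by simp
  ultimately have "\<beta> * \<sigma> * norm (c y)
      \<le> 8 * (K * norm (tjac A y *v grad f (A y) + \<beta> *\<^sub>R (tjac c y *v c y)))"
    by linarith
  then show ?thesis
    unfolding grad_eqI[OF GDERIV_cdf_fun[OF f_diff c_diff A_diff]] \<sigma>_def[symmetric] K_def[symmetric]
    using K by (simp add: pos_divide_le_eq mult_ac)
qed simp

text \<open>For \<open>k\<close> in the kernel of the Jacobian of \<open>c\<close>, the transpose of \<open>J\<^sub>A(y)\<close> fixes \<open>k\<close>, so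
\<open>k \<bullet> \<nabla>f = k \<bullet> J\<^sub>A(y) \<nabla>f = 0\<close>. Thus \<open>\<nabla>f\<close> is orthogonal to that kernel, that is, a combination of
the constraint gradients.\<close>
lemma ocp_stationary_if_JA_grad_zero:
  fixes f :: "real^'n \<Rightarrow> real" and c :: "real^'n \<Rightarrow> real^'p" and A :: "real^'n \<Rightarrow> real^'n"
  assumes c_diff: "\<And>z. c differentiable (at z)"
    and A_diff: "A differentiable (at y)"
    and cont: "isCont (\<lambda>u. mat_op (tjac c u)) y"
    and rank: "rank (tjac c y) = CARD('p)"
    and A_fix: "\<And>z. c z = 0 \<Longrightarrow> A z = z"
    and cy: "c y = 0" and zero: "tjac A y *v grad f y = 0"
  shows "ocp_stationary f c y"
proof -
  have "grad f y \<bullet> k = 0" if ker: "transpose (tjac c y) *v k = 0" for k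
  proof -
    have "transpose (tjac A y) *v k = k"
      by (rule retraction_derivative_fixes_kernel[OF c_diff cont rank cy ker A_diff A_fix])
    then have "k \<bullet> grad f y = k \<bullet> (tjac A y *v grad f y)"
      by (metis inner_transpose_matrix_vector)
    then show ?thesis by (simp add: zero inner_commute)
  qed
  then obtain l where l: "grad f y = tjac c y *v l"
    using in_range_if_orthogonal_to_transpose_kernel[OF rank] by blast
  have col: "grad (\<lambda>u. c u $ i) y = column i (tjac c y)" for i
  proof (rule grad_eqI, unfold gderiv_def)
    have "((\<lambda>u. c u $ i) has_derivative (\<lambda>k. (transpose (tjac c y) *v k) $ i)) (at y)"
      by (rule bounded_linear.has_derivative[OF bounded_linear_vec_nth has_derivative_tjac[OF c_diff]])
    then show "((\<lambda>u. c u $ i) has_derivative (\<lambda>k. k \<bullet> column i (tjac c y))) (at y)"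
      by (simp add: transpose_def matrix_vector_mult_def inner_vec_def column_def mult.commute
          del: transpose_matrix_vector)
  qed
  have "grad f y = (\<Sum>i\<in>UNIV. (l $ i) *\<^sub>R grad (\<lambda>u. c u $ i) y)"
    unfolding l col by (simp add: matrix_mult_sum scalar_mult_eq_scaleR)
  then show ?thesis unfolding ocp_stationary_def using cy by blast
qed

theorem theorem3p10:
  fixes f :: "real^'n \<Rightarrow> real"
    and c :: "real^'n \<Rightarrow> real^'p"
    and A :: "real^'n \<Rightarrow> real^'n"
    and \<beta> :: real
    and x :: "real^'n"
  assumes f_diff: "\<And>z. f differentiable (at z)"
    and c_diff: "\<And>z. c differentiable (at z)"
    and A_diff: "\<And>z. A differentiable (at z)"
    and grad_f_lip: "locally_lipschitz (grad f)"
    and Jc_lip: "locally_lipschitz (\<lambda>z. mat_op (tjac c z))"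
    and JA_lip: "locally_lipschitz (\<lambda>z. mat_op (tjac A z))"
    and Jc_full_rank: "\<And>z. z \<in> feasible c \<Longrightarrow> rank (tjac c z) = CARD('p)"
    and A_fix: "\<And>z. z \<in> feasible c \<Longrightarrow> A z = z"
    and JA_Jc: "\<And>z. z \<in> feasible c \<Longrightarrow> tjac A z ** tjac c z = 0"
    and beta_pos: "\<beta> > 0"
    and x_feasible: "x \<in> feasible c"
    and beta_ge: "\<beta> \<ge> beta_thr f c A x"
  shows "(\<forall>y \<in> Omega c A x.
            norm (grad (cdf_fun f c A \<beta>) y)
              \<ge> \<beta> * sigma_c c x / (8 * (M_A c A x + 1)) * norm (c y)) \<and>
         (\<forall>y \<in> Omega c A x. cdf_stationary f c A \<beta> y \<longrightarrow> ocp_stationary f c y)"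
proof -
  have bound: "\<beta> * sigma_c c x / (8 * (M_A c A x + 1)) * norm (c y)
      \<le> norm (grad (cdf_fun f c A \<beta>) y)" if "y \<in> Omega c A x" for y
    using assms that by (rule cdf_grad_lower_bound)
  have "ocp_stationary f c y"
    if y: "y \<in> Omega c A x" and stat: "cdf_stationary f c A \<beta> y" for y
  proof -
    \<comment> \<open>The mere existence of a point of \<open>\<Omega>\<^sub>x\<close> makes \<open>\<Theta>\<^sub>x\<close> nonempty, which yields \<open>0 \<le> M_A\<close>.\<close>
    have "0 \<le> rho c x"
      using y order_trans[of 0 "ereal (norm (y - x))" "ereal (rho c x / 2)"]
      by (auto simp: Omega_def eps_def)
    then have "norm (mat_op (tjac A x)) \<le> M_A c A x"
      unfolding M_A_def Theta_eq_cball
      by (intro norm_le_SUP[OF locally_lipschitz_imp_continuous_on[OF JA_lip]]) auto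
    then have "0 < M_A c A x + 1" using norm_ge_zero[of "mat_op (tjac A x)"] by linarith
    moreover have "0 < sigma_c c x"
      unfolding sigma_c_def by (rule sigma_min_pos[OF Jc_full_rank[OF x_feasible]])
    ultimately have "0 < \<beta> * sigma_c c x / (8 * (M_A c A x + 1))"
      using beta_pos by simp
    moreover have "\<beta> * sigma_c c x / (8 * (M_A c A x + 1)) * norm (c y) \<le> 0"
      using bound[OF y] stat by (simp add: cdf_stationary_def)
    ultimately have "norm (c y) \<le> 0" by (metis mult_le_0_iff not_less)
    then have cy: "c y = 0" by simp
    then have Ay: "A y = y" by (simp add: A_fix feasible_def)
    have "tjac A y *v grad f y = 0"
      using stat unfolding cdf_stationary_def grad_eqI[OF GDERIV_cdf_fun[OF f_diff c_diff A_diff]]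
      by (simp add: cy Ay)
    moreover have "isCont (\<lambda>u. mat_op (tjac c u)) y"
      using locally_lipschitz_imp_continuous_on[OF Jc_lip, of UNIV]
      by (simp add: continuous_on_eq_continuous_at)
    ultimately show ?thesis
      using cy by (intro ocp_stationary_if_JA_grad_zero[OF c_diff A_diff])
        (auto simp: Jc_full_rank A_fix feasible_def)
  qed
  then show ?thesis using bound by blast
qed

end
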